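(* Let $I \subseteq \mathbb{R}$ be an interval, let $f : I \to \mathbb{R}$ be a function, and let $m$ be a subadditive modulus of continuity. Then $f$ is uniformly $m$-differentiable on $I$ if and only if $f(x) - f(a)$ is divisible by $x - a$ in the class of $m$-continuous functions of two variables, i.e. if and only if there is an $m$-continuous function $Q : I \times I \to \mathbb{R}$ such that $f(x) - f(a) = (x-a)\, Q(x,a)$ for all $x, a \in I$. In particular (taking $m(t) = t$), $f$ is uniformly Lipschitz differentiable if and only if $f(x) - f(a)$ is divisible by $x-a$ in the class of Lipschitz functions of the two variables $x$ and $a$.
   Context: A (subadditive) modulus of continuity is a function $m : [0,\infty) \to [0,\infty)$ that is increasing (in the non-strict sense), continuous at $0$, with $m(0) = 0$, and subadditive: $m(x+y) \leqslant m(x) + m(y)$ for all $x, y \geqslant 0$. A function $f : I \to \mathbb{R}$ is uniformly $m$-differentiable if there are a function $f' : I \to \mathbb{R}$ and a constant $K$, independent of $x$ and $a$, such that $|f(x) - f(a) - f'(a)(x-a)| \leqslant K|x-a|\, m(|x-a|)$ for all $x, a \in I$; for $m(t) = t$ this is called uniform Lipschitz differentiability. A function $Q : I \times I \to \mathbb{R}$ is $m$-continuous if there is a constant $C$ such that $|Q(x,a) - Q(y,b)| \leqslant C\, m(|x-y| + |a-b|)$ for all $x, a, y, b \in I$; for $m(t) = t$ this means that $Q$ is Lipschitz. *)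

theory Defs
  imports "HOL-Analysis.Analysis"
begin

text \<open>
  Functions on \<open>I\<close>, on \<open>I \<times> I\<close> or on \<open>[0,\<infinity>)\<close> are total functions, of which only the values on the
  respective domain matter.
\<close>

definition subadditive_modulus :: "(real \<Rightarrow> real) \<Rightarrow> bool" where
  "subadditive_modulus m \<longleftrightarrow>
     (\<forall>t\<ge>0. 0 \<le> m t) \<and>
     mono_on {0..} m \<and>
     continuous (at 0 within {0..}) m \<and>
     m 0 = 0 \<and>
     (\<forall>x\<ge>0. \<forall>y\<ge>0. m (x + y) \<le> m x + m y)"

definition uniformly_m_differentiable_on ::
    "(real \<Rightarrow> real) \<Rightarrow> real set \<Rightarrow> (real \<Rightarrow> real) \<Rightarrow> bool" where
  "uniformly_m_differentiable_on m I f \<longleftrightarrow>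
     (\<exists>f' K. \<forall>x\<in>I. \<forall>a\<in>I.
        \<bar>f x - f a - f' a * (x - a)\<bar> \<le> K * \<bar>x - a\<bar> * m \<bar>x - a\<bar>)"

definition uniformly_Lipschitz_differentiable_on ::
    "real set \<Rightarrow> (real \<Rightarrow> real) \<Rightarrow> bool" where
  "uniformly_Lipschitz_differentiable_on I f \<longleftrightarrow> uniformly_m_differentiable_on (\<lambda>t. t) I f"

definition m_continuous_on2 ::
    "(real \<Rightarrow> real) \<Rightarrow> real set \<Rightarrow> (real \<times> real \<Rightarrow> real) \<Rightarrow> bool" where
  "m_continuous_on2 m I Q \<longleftrightarrow>
     (\<exists>C. \<forall>x\<in>I. \<forall>a\<in>I. \<forall>y\<in>I. \<forall>b\<in>I.
        \<bar>Q (x, a) - Q (y, b)\<bar> \<le> C * m (\<bar>x - y\<bar> + \<bar>a - b\<bar>))"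

text \<open>
  The library's Lipschitz condition uses the Euclidean distance on the plane rather than the
  sum of the coordinate distances; up to the constant, this makes no difference.
\<close>

lemma m_continuous_on2_id_iff_lipschitz:
  "m_continuous_on2 (\<lambda>t. t) I Q \<longleftrightarrow> (\<exists>L. L-lipschitz_on (I \<times> I) Q)"
proof
  assume "m_continuous_on2 (\<lambda>t. t) I Q"
  then obtain C where C: "\<And>x a y b. \<lbrakk>x \<in> I; a \<in> I; y \<in> I; b \<in> I\<rbrakk> \<Longrightarrow>
      \<bar>Q (x, a) - Q (y, b)\<bar> \<le> C * (\<bar>x - y\<bar> + \<bar>a - b\<bar>)"
    unfolding m_continuous_on2_def by blast
  have "(2 * \<bar>C\<bar>)-lipschitz_on (I \<times> I) Q"
  proof (rule lipschitz_onI)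
    fix p q assume "p \<in> I \<times> I" "q \<in> I \<times> I"
    then obtain x a y b where pq: "p = (x, a)" "q = (y, b)" "x \<in> I" "a \<in> I" "y \<in> I" "b \<in> I"
      by auto
    have d: "\<bar>x - y\<bar> \<le> dist p q" "\<bar>a - b\<bar> \<le> dist p q"
      using dist_fst_le[of p q] dist_snd_le[of p q] pq by (auto simp: dist_real_def)
    have "\<bar>Q (x, a) - Q (y, b)\<bar> \<le> C * (\<bar>x - y\<bar> + \<bar>a - b\<bar>)"
      using C pq by blast
    also have "\<dots> \<le> \<bar>C\<bar> * (2 * dist p q)"
      using d by (intro mult_mono) auto
    finally show "dist (Q p) (Q q) \<le> 2 * \<bar>C\<bar> * dist p q"
      using pq by (simp add: dist_real_def)
  qed simp
  then show "\<exists>L. L-lipschitz_on (I \<times> I) Q" by blast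
next
  assume "\<exists>L. L-lipschitz_on (I \<times> I) Q"
  then obtain L where L: "L-lipschitz_on (I \<times> I) Q" by blast
  have "\<bar>Q (x, a) - Q (y, b)\<bar> \<le> L * (\<bar>x - y\<bar> + \<bar>a - b\<bar>)"
    if "x \<in> I" "a \<in> I" "y \<in> I" "b \<in> I" for x a y b
  proof -
    have "\<bar>Q (x, a) - Q (y, b)\<bar> \<le> L * dist (x, a) (y, b)"
      using lipschitz_onD[OF L, of "(x, a)" "(y, b)"] that by (simp add: dist_real_def)
    also have "\<dots> \<le> L * (\<bar>x - y\<bar> + \<bar>a - b\<bar>)"
      using lipschitz_on_nonneg[OF L] sqrt_sum_squares_le_sum_abs[of "x - y" "a - b"]
      by (intro mult_left_mono) (auto simp: dist_Pair_Pair dist_real_def)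
    finally show ?thesis .
  qed
  then show "m_continuous_on2 (\<lambda>t. t) I Q"
    unfolding m_continuous_on2_def by blast
qed

end

theory Submission
  imports Defs
begin

text \<open>
  If \<open>f x - f a = (x - a) * Q (x, a)\<close> with an \<open>m\<close>-continuous \<open>Q\<close>, then \<open>Q (a, a)\<close> is a uniform
  \<open>m\<close>-derivative, because the error of the linear approximation is \<open>x - a\<close> times
  \<open>Q (x, a) - Q (a, a)\<close>.

  Conversely, given a uniform \<open>m\<close>-derivative \<open>f'\<close>, off the diagonal \<open>Q\<close> has to be the difference
  quotient, and on the diagonal it is given the value \<open>f'\<close>.  The hypothesis compares
  \<open>Q (x, a)\<close> with \<open>f' a\<close>, and hence, by symmetry of \<open>Q\<close>, also with \<open>f' x\<close>, up to a multiple of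
  \<open>m \<bar>x - a\<bar>\<close>.  By the symmetry it is enough to estimate \<open>Q\<close> under a change of the first argument
  from \<open>x\<close> to \<open>y\<close>.  Directly comparing both values with \<open>f' a\<close> bounds the change by
  \<open>m \<bar>x - a\<bar> + m \<bar>y - a\<bar>\<close>, which is useless if \<open>a\<close> is far away from \<open>x\<close> and \<open>y\<close>.
  The way out is that the increments of \<open>f\<close> add up,
  \<open>(y - a) * Q (y, a) = (y - x) * Q (y, x) + (x - a) * Q (x, a)\<close>, so that
  \<open>(y - a) * (Q (y, a) - Q (x, a)) = (y - x) * (Q (y, x) - Q (x, a))\<close>.
  The two quotients on the right are both close to \<open>f' x\<close>.  The error \<open>m \<bar>x - a\<bar>\<close> of the
  second one may be large, but a subadditive modulus grows at most linearly, so \<open>m \<bar>x - a\<bar>\<close> is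
  at most \<open>\<bar>x - a\<bar> / \<bar>y - x\<bar> + 1\<close> times \<open>m \<bar>y - x\<bar>\<close> (lemma \<open>subadditive_modulus_le_linear\<close>), and
  the factor \<open>\<bar>y - x\<bar> / \<bar>y - a\<bar>\<close> compensates for this when \<open>y\<close> is the one of the two points
  that is further from \<open>a\<close>.
\<close>

lemma subadditive_modulus_mult_nat:
  assumes "subadditive_modulus m" and "0 \<le> h"
  shows "m (real n * h) \<le> real n * m h"
proof (induction n)
  case 0
  show ?case
    using assms(1) by (simp add: subadditive_modulus_def)
next
  case (Suc n)
  have "m (real n * h + h) \<le> m (real n * h) + m h"
    using assms by (auto simp: subadditive_modulus_def)
  with Suc.IH show ?case
    by (simp add: algebra_simps)
qed

text \<open>
  Cover \<open>[0, s]\<close> by \<open>\<lceil>s / h\<rceil>\<close> intervals of length \<open>h\<close>.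
\<close>

lemma subadditive_modulus_le_linear:
  assumes m: "subadditive_modulus m" and "0 < h" and "0 \<le> s"
  shows "h * m s \<le> (s + h) * m h"
proof -
  define n where "n = nat \<lceil>s / h\<rceil>"
  have n: "s / h \<le> real n" "real n \<le> s / h + 1"
    using assms(2,3) by (auto simp: n_def real_nat_ceiling_ge intro: of_int_ceiling_le_add_one)
  have "s \<le> real n * h"
    using n(1) assms(2) by (simp add: field_simps)
  then have "m s \<le> m (real n * h)"
    using m assms(3) by (auto simp: subadditive_modulus_def mono_on_def)
  also have "\<dots> \<le> real n * m h"
    using subadditive_modulus_mult_nat[OF m] assms(2) by simp
  also have "\<dots> \<le> (s / h + 1) * m h"
    using n(2) m assms(2) by (intro mult_right_mono) (auto simp: subadditive_modulus_def)
  finally have "h * m s \<le> h * ((s / h + 1) * m h)"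
    using assms(2) by simp
  also have "\<dots> = (s + h) * m h"
    using assms(2) by (simp add: field_simps)
  finally show ?thesis .
qed

definition difference_quotient :: "(real \<Rightarrow> real) \<Rightarrow> (real \<Rightarrow> real) \<Rightarrow> real \<times> real \<Rightarrow> real" where
  "difference_quotient f f' = (\<lambda>(x, a). if x = a then f' a else (f x - f a) / (x - a))"

lemma difference_quotient_mult: "(x - a) * difference_quotient f f' (x, a) = f x - f a"
  by (simp add: difference_quotient_def)

lemma difference_quotient_commute:
  "difference_quotient f f' (x, a) = difference_quotient f f' (a, x)"
  using minus_divide_divide[of "f x - f a" "x - a"] by (simp add: difference_quotient_def)

lemma difference_quotient_near_derivative:
  assumes m: "subadditive_modulus m"
    and "\<bar>f x - f a - f' a * (x - a)\<bar> \<le> K * \<bar>x - a\<bar> * m \<bar>x - a\<bar>"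
  shows "\<bar>difference_quotient f f' (x, a) - f' a\<bar> \<le> K * m \<bar>x - a\<bar>"
proof (cases "x = a")
  case True
  then show ?thesis
    using m by (simp add: difference_quotient_def subadditive_modulus_def)
next
  case False
  let ?q = "difference_quotient f f' (x, a)"
  have "\<bar>x - a\<bar> * \<bar>?q - f' a\<bar> = \<bar>f x - f a - f' a * (x - a)\<bar>"
    by (simp add: difference_quotient_mult [symmetric, where f' = f'] abs_mult [symmetric]
        algebra_simps)
  also have "\<dots> \<le> \<bar>x - a\<bar> * (K * m \<bar>x - a\<bar>)"
    using assms(2) by (simp add: mult_ac)
  finally show ?thesis
    using False by simp
qed

text \<open>
  The core of the argument: the distance of \<open>a\<close> from \<open>x\<close> and \<open>y\<close> does not enter the bound.
  The constant arises from \<open>2 * \<bar>y - x\<bar> + \<bar>x - a\<bar> \<le> 5 * \<bar>y - a\<bar>\<close>.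
\<close>

lemma difference_quotient_change_first_arg_far:
  assumes m: "subadditive_modulus m" and "0 \<le> K"
    and near: "\<And>x a. x \<in> I \<Longrightarrow> a \<in> I \<Longrightarrow>
      \<bar>difference_quotient f f' (x, a) - f' a\<bar> \<le> K * m \<bar>x - a\<bar>"
    and I: "x \<in> I" "y \<in> I" "a \<in> I"
    and far: "\<bar>x - a\<bar> \<le> \<bar>y - a\<bar>"
  shows "\<bar>difference_quotient f f' (y, a) - difference_quotient f f' (x, a)\<bar> \<le> 5 * K * m \<bar>y - x\<bar>"
proof (cases "x = y")
  case True
  then show ?thesis
    using m by (simp add: subadditive_modulus_def)
next
  case False
  let ?Q = "difference_quotient f f'"
  define h where "h = \<bar>y - x\<bar>"
  have h: "0 < h" "h \<le> 2 * \<bar>y - a\<bar>"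
    using False far abs_triangle_ineq4[of "y - a" "x - a"] by (auto simp: h_def)
  have ya: "0 < \<bar>y - a\<bar>"
    using h by auto
  have mh: "0 \<le> m h"
    using m h by (simp add: subadditive_modulus_def)
  have "(y - a) * ?Q (y, a) = (y - x) * ?Q (y, x) + (x - a) * ?Q (x, a)"
    by (simp add: difference_quotient_mult)
  then have "(y - a) * (?Q (y, a) - ?Q (x, a)) = (y - x) * (?Q (y, x) - ?Q (x, a))"
    by (simp add: algebra_simps)
  then have "\<bar>y - a\<bar> * \<bar>?Q (y, a) - ?Q (x, a)\<bar> = h * \<bar>?Q (y, x) - ?Q (x, a)\<bar>"
    unfolding h_def by (metis abs_mult)
  also have "\<dots> \<le> h * (K * m h + K * m \<bar>x - a\<bar>)"
  proof (rule mult_left_mono)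
    have "\<bar>?Q (y, x) - f' x\<bar> \<le> K * m h"
      using near I by (simp add: h_def)
    moreover have "\<bar>?Q (x, a) - f' x\<bar> \<le> K * m \<bar>x - a\<bar>"
      using near[of a x] I by (simp add: difference_quotient_commute[of _ _ x a] abs_minus_commute)
    ultimately show "\<bar>?Q (y, x) - ?Q (x, a)\<bar> \<le> K * m h + K * m \<bar>x - a\<bar>"
      by linarith
  qed (use h in simp)
  also have "\<dots> = K * (h * m h + h * m \<bar>x - a\<bar>)"
    by (simp add: algebra_simps)
  also have "\<dots> \<le> K * (h * m h + (\<bar>x - a\<bar> + h) * m h)"
    using subadditive_modulus_le_linear[OF m h(1), of "\<bar>x - a\<bar>"] \<open>0 \<le> K\<close>
    by (intro mult_left_mono) auto
  also have "\<dots> = K * ((2 * h + \<bar>x - a\<bar>) * m h)"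
    by (simp add: algebra_simps)
  also have "\<dots> \<le> K * ((5 * \<bar>y - a\<bar>) * m h)"
    using h far mh \<open>0 \<le> K\<close> by (intro mult_left_mono mult_right_mono) auto
  also have "\<dots> = \<bar>y - a\<bar> * (5 * K * m h)"
    by simp
  finally show ?thesis
    using ya by (simp add: h_def)
qed

lemma difference_quotient_change_first_arg:
  assumes m: "subadditive_modulus m" and "0 \<le> K"
    and near: "\<And>x a. x \<in> I \<Longrightarrow> a \<in> I \<Longrightarrow>
      \<bar>difference_quotient f f' (x, a) - f' a\<bar> \<le> K * m \<bar>x - a\<bar>"
    and I: "x \<in> I" "y \<in> I" "a \<in> I"
  shows "\<bar>difference_quotient f f' (x, a) - difference_quotient f f' (y, a)\<bar> \<le> 5 * K * m \<bar>x - y\<bar>"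
proof (cases "\<bar>x - a\<bar> \<le> \<bar>y - a\<bar>")
  case True
  then show ?thesis
    using difference_quotient_change_first_arg_far[OF m \<open>0 \<le> K\<close> near I]
    by (simp add: abs_minus_commute)
next
  case False
  then show ?thesis
    using difference_quotient_change_first_arg_far[OF m \<open>0 \<le> K\<close> near I(2,1,3)] by simp
qed

lemma m_continuous_difference_quotient:
  assumes m: "subadditive_modulus m" and "0 \<le> K"
    and near: "\<And>x a. x \<in> I \<Longrightarrow> a \<in> I \<Longrightarrow>
      \<bar>difference_quotient f f' (x, a) - f' a\<bar> \<le> K * m \<bar>x - a\<bar>"
  shows "m_continuous_on2 m I (difference_quotient f f')"
  unfolding m_continuous_on2_def
proof (intro exI ballI)
  fix x a y b
  assume I: "x \<in> I" "a \<in> I" "y \<in> I" "b \<in> I"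
  let ?Q = "difference_quotient f f'"
  let ?d = "\<bar>x - y\<bar> + \<bar>a - b\<bar>"
  have change: "\<bar>?Q (u, c) - ?Q (v, c)\<bar> \<le> 5 * K * m \<bar>u - v\<bar>"
    if "u \<in> I" "v \<in> I" "c \<in> I" for u v c
    by (rule difference_quotient_change_first_arg[where f = f, OF m \<open>0 \<le> K\<close> near that])
  have mono: "5 * K * m \<bar>x - y\<bar> \<le> 5 * K * m ?d" "5 * K * m \<bar>a - b\<bar> \<le> 5 * K * m ?d"
    using m \<open>0 \<le> K\<close>
    by (auto intro!: mult_left_mono simp: subadditive_modulus_def mono_on_def)
  have "\<bar>?Q (x, a) - ?Q (y, a)\<bar> \<le> 5 * K * m \<bar>x - y\<bar>"
    using change I by blast
  moreover have "\<bar>?Q (y, a) - ?Q (y, b)\<bar> \<le> 5 * K * m \<bar>a - b\<bar>"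
    using change[of a b y] I by (simp add: difference_quotient_commute[of _ _ y])
  ultimately show "\<bar>?Q (x, a) - ?Q (y, b)\<bar> \<le> (10 * K) * m ?d"
    using mono by linarith
qed

lemma uniformly_m_differentiable_on_imp_divisible:
  assumes m: "subadditive_modulus m" and "uniformly_m_differentiable_on m I f"
  shows "\<exists>Q. m_continuous_on2 m I Q \<and> (\<forall>x\<in>I. \<forall>a\<in>I. f x - f a = (x - a) * Q (x, a))"
proof -
  obtain f' K where K: "\<And>x a. x \<in> I \<Longrightarrow> a \<in> I \<Longrightarrow>
      \<bar>f x - f a - f' a * (x - a)\<bar> \<le> K * \<bar>x - a\<bar> * m \<bar>x - a\<bar>"
    using assms(2) unfolding uniformly_m_differentiable_on_def by blast
  have near: "\<bar>difference_quotient f f' (x, a) - f' a\<bar> \<le> \<bar>K\<bar> * m \<bar>x - a\<bar>"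
    if "x \<in> I" "a \<in> I" for x a
  proof -
    have "\<bar>difference_quotient f f' (x, a) - f' a\<bar> \<le> K * m \<bar>x - a\<bar>"
      by (rule difference_quotient_near_derivative[where f = f and f' = f', OF m K[OF that]])
    also have "\<dots> \<le> \<bar>K\<bar> * m \<bar>x - a\<bar>"
      using m by (intro mult_right_mono) (auto simp: subadditive_modulus_def)
    finally show ?thesis .
  qed
  have "m_continuous_on2 m I (difference_quotient f f')"
    by (rule m_continuous_difference_quotient[OF m _ near]) auto
  then show ?thesis
    by (metis difference_quotient_mult)
qed

lemma divisible_imp_uniformly_m_differentiable_on:
  assumes "m_continuous_on2 m I Q"
    and Q: "\<forall>x\<in>I. \<forall>a\<in>I. f x - f a = (x - a) * Q (x, a)"
  shows "uniformly_m_differentiable_on m I f"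
proof -
  obtain C where C: "\<And>x a y b. x \<in> I \<Longrightarrow> a \<in> I \<Longrightarrow> y \<in> I \<Longrightarrow> b \<in> I \<Longrightarrow>
      \<bar>Q (x, a) - Q (y, b)\<bar> \<le> C * m (\<bar>x - y\<bar> + \<bar>a - b\<bar>)"
    using assms(1) unfolding m_continuous_on2_def by blast
  show ?thesis
    unfolding uniformly_m_differentiable_on_def
  proof (intro exI ballI)
    fix x a
    assume I: "x \<in> I" "a \<in> I"
    have "f x - f a - Q (a, a) * (x - a) = (x - a) * (Q (x, a) - Q (a, a))"
      using Q I by (simp add: algebra_simps)
    then have "\<bar>f x - f a - Q (a, a) * (x - a)\<bar> = \<bar>x - a\<bar> * \<bar>Q (x, a) - Q (a, a)\<bar>"
      by (simp add: abs_mult)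
    also have "\<dots> \<le> \<bar>x - a\<bar> * (C * m \<bar>x - a\<bar>)"
      using C[of x a a a] I by (intro mult_left_mono) auto
    finally show "\<bar>f x - f a - Q (a, a) * (x - a)\<bar> \<le> C * \<bar>x - a\<bar> * m \<bar>x - a\<bar>"
      by (simp add: mult_ac)
  qed
qed

lemma uniformly_m_differentiable_on_iff_divisible:
  assumes "subadditive_modulus m"
  shows "uniformly_m_differentiable_on m I f \<longleftrightarrow>
    (\<exists>Q. m_continuous_on2 m I Q \<and> (\<forall>x\<in>I. \<forall>a\<in>I. f x - f a = (x - a) * Q (x, a)))"
  using uniformly_m_differentiable_on_imp_divisible[OF assms]
    divisible_imp_uniformly_m_differentiable_on by blast

lemma subadditive_modulus_id: "subadditive_modulus (\<lambda>t. t)"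
  by (simp add: subadditive_modulus_def mono_on_def)

theorem mainTheorem3:
  fixes I :: "real set" and f m :: "real \<Rightarrow> real"
  assumes "is_interval I"
    and "subadditive_modulus m"
  shows "(uniformly_m_differentiable_on m I f \<longleftrightarrow>
           (\<exists>Q :: real \<times> real \<Rightarrow> real. m_continuous_on2 m I Q \<and>
              (\<forall>x\<in>I. \<forall>a\<in>I. f x - f a = (x - a) * Q (x, a))))
       \<and> (uniformly_Lipschitz_differentiable_on I f \<longleftrightarrow>
           (\<exists>Q :: real \<times> real \<Rightarrow> real. (\<exists>L. L-lipschitz_on (I \<times> I) Q) \<and>
              (\<forall>x\<in>I. \<forall>a\<in>I. f x - f a = (x - a) * Q (x, a))))"
  using uniformly_m_differentiable_on_iff_divisible[OF assms(2), of I f]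
    uniformly_m_differentiable_on_iff_divisible[OF subadditive_modulus_id, of I f]
  by (simp only: uniformly_Lipschitz_differentiable_on_def m_continuous_on2_id_iff_lipschitz)

end
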